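(* Let $G$ be a compact topological group acting continuously and faithfully on a compact metric space $(X, m)$. Let $\mathcal{A} \subseteq G$ be a finite set containing at least two points, write $|\mathcal{A}|$ for its cardinality, and define $$\delta(\mathcal{A}) = \min\{\varphi(ab^{-1}) : a \in \mathcal{A},\ b \in \mathcal{A},\ \text{and } a \ne b\}.$$ Then $$\Phi\big(\tfrac12 \delta(\mathcal{A})\big) \le |\mathcal{A}|^{-1}.$$ If, moreover, the metric $m$ is nonarchimedean, then $$\Phi\big(\delta(\mathcal{A})\big) \le |\mathcal{A}|^{-1}.$$
   Context: The action $G \times X \to X$, $(g,x) \mapsto gx$, is continuous (jointly) and faithful. The function $\varphi : G \to [0,\infty)$ is $\varphi(g) = \sup\{m(gx, x) : x \in X\}$. $\mu$ denotes the Haar measure on the Borel subsets of $G$ normalized so that $\mu(G) = 1$ (it is both left and right invariant), and for $t \ge 0$, $\Phi(t) = \mu\{g \in G : \varphi(g) < t\}$. The metric $m$ is nonarchimedean if $m(x,y) \le \max\{m(x,z), m(z,y)\}$ for all $x, y, z \in X$. *)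

theory Defs
  imports "HOL-Analysis.Analysis" "HOL-Algebra.Group_Action"
begin

(* No separation axiom is built in. *)
locale topological_group = group G for G (structure) +
  fixes T :: "'a topology"
  assumes topspace_eq_carrier: "topspace T = carrier G"
    and continuous_mult: "continuous_map (prod_topology T T) T (\<lambda>(x, y). x \<otimes> y)"
    and continuous_inv: "continuous_map T T (\<lambda>x. inv x)"

definition borel_algebra_of :: "'a topology \<Rightarrow> 'a set set" where
  "borel_algebra_of T = sigma_sets (topspace T) {U. openin T U}"

(* Only left invariance is demanded; on a compact group right invariance follows. *)
definition normalized_haar_measure ::
    "('a, 'b) monoid_scheme \<Rightarrow> 'a topology \<Rightarrow> 'a measure \<Rightarrow> bool" where
  "normalized_haar_measure G T \<mu> \<longleftrightarrow>
     space \<mu> = topspace T \<and>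
     sets \<mu> = borel_algebra_of T \<and>
     emeasure \<mu> (carrier G) = 1 \<and>
     (\<forall>g \<in> carrier G. \<forall>B \<in> sets \<mu>. emeasure \<mu> (g <#\<^bsub>G\<^esub> B) = emeasure \<mu> B) \<and>
     (\<forall>B \<in> sets \<mu>. emeasure \<mu> B = (INF U \<in> {U. openin T U \<and> B \<subseteq> U}. emeasure \<mu> U)) \<and>
     (\<forall>U. openin T U \<longrightarrow>
        emeasure \<mu> U = (SUP K \<in> {K. compactin T K \<and> K \<subseteq> U}. emeasure \<mu> K))"

definition nonarchimedean_on :: "'x set \<Rightarrow> ('x \<Rightarrow> 'x \<Rightarrow> real) \<Rightarrow> bool" where
  "nonarchimedean_on X m \<longleftrightarrow>
     (\<forall>x \<in> X. \<forall>y \<in> X. \<forall>z \<in> X. m x y \<le> max (m x z) (m z y))"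

(* The function written phi in the literature. The real supremum is over a bounded set
   when (X, m) is compact; X is nonempty as soon as a group with two elements acts
   faithfully on it. *)
definition displacement ::
    "'x set \<Rightarrow> ('x \<Rightarrow> 'x \<Rightarrow> real) \<Rightarrow> ('a \<Rightarrow> 'x \<Rightarrow> 'x) \<Rightarrow> 'a \<Rightarrow> real" where
  "displacement X m act g = (SUP x \<in> X. m (act g x) x)"

(* The function written Phi in the literature. *)
definition displacement_distribution ::
    "('a, 'b) monoid_scheme \<Rightarrow> 'x set \<Rightarrow> ('x \<Rightarrow> 'x \<Rightarrow> real) \<Rightarrow> ('a \<Rightarrow> 'x \<Rightarrow> 'x) \<Rightarrow>
       'a measure \<Rightarrow> real \<Rightarrow> real" where
  "displacement_distribution G X m act \<mu> t =
     measure \<mu> {g \<in> carrier G. displacement X m act g < t}"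

definition min_displacement ::
    "('a, 'b) monoid_scheme \<Rightarrow> 'x set \<Rightarrow> ('x \<Rightarrow> 'x \<Rightarrow> real) \<Rightarrow> ('a \<Rightarrow> 'x \<Rightarrow> 'x) \<Rightarrow>
       'a set \<Rightarrow> real" where
  "min_displacement G X m act A =
     Min {displacement X m act (a \<otimes>\<^bsub>G\<^esub> inv\<^bsub>G\<^esub> b) | a b. a \<in> A \<and> b \<in> A \<and> a \<noteq> b}"

end

theory Submission
  imports Defs
begin

text \<open>
  The bound is a packing argument. Let \<open>B\<close> be the set of group elements whose displacement, the
  largest distance by which they move a point of \<open>X\<close>, is below \<open>r\<close>. The displacement behaves
  like a length function on the group: it is invariant under inversion and subadditive, so every
  quotient \<open>g h\<^sup>-\<^sup>1\<close> of elements of \<open>B\<close> has displacement below \<open>2 r\<close>, and below \<open>r\<close> if the metric is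
  nonarchimedean. With \<open>r\<close> equal to half the minimal displacement \<open>\<delta>\<close> of \<open>A\<close> (respectively to
  \<open>\<delta>\<close> itself) no such quotient can be of the form \<open>a b\<^sup>-\<^sup>1\<close> with distinct \<open>a, b \<in> A\<close>. This says
  exactly that the left translates \<open>a\<^sup>-\<^sup>1 B\<close>, for \<open>a \<in> A\<close>, are pairwise disjoint. They all have the
  measure of \<open>B\<close> and fit into a group of total measure 1, so \<open>B\<close> has measure at most \<open>1 / |A|\<close>.
  Translating by the inverses \<open>a\<^sup>-\<^sup>1\<close> from the left, rather than by \<open>a\<close> from the right, makes left
  invariance of the measure the appropriate form of invariance.
\<close>

lemma (in group) disjoint_left_translates:
  assumes A: "A \<subseteq> carrier G" and B: "B \<subseteq> carrier G"
    and quotients: "\<And>a b g h. \<lbrakk>a \<in> A; b \<in> A; a \<noteq> b; g \<in> B; h \<in> B\<rbrakk>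
                      \<Longrightarrow> a \<otimes> inv b \<noteq> g \<otimes> inv h"
  shows "disjoint_family_on (\<lambda>a. inv a <# B) A"
  unfolding disjoint_family_on_def
proof (intro ballI impI)
  fix a b
  assume ab: "a \<in> A" "b \<in> A" "a \<noteq> b"
  show "(inv a <# B) \<inter> (inv b <# B) = {}"
  proof (rule ccontr)
    assume "(inv a <# B) \<inter> (inv b <# B) \<noteq> {}"
    then obtain g h where gh: "g \<in> B" "h \<in> B" "inv a \<otimes> g = inv b \<otimes> h"
      unfolding l_coset_def by blast
    have carr: "a \<in> carrier G" "b \<in> carrier G" "g \<in> carrier G" "h \<in> carrier G"
      using ab gh A B by auto
    have "g = a \<otimes> (inv b \<otimes> h)"
      using gh(3) carr by (metis inv_closed inv_solve_left' m_closed inv_inv inv_solve_left)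
    hence "g \<otimes> inv h = a \<otimes> inv b"
      using carr by (simp add: m_assoc)
    thus False
      using quotients[OF ab gh(1,2)] by simp
  qed
qed

text \<open>
  The measure of a nonmeasurable set is 0 by convention, so the bound is a statement about sets of
  positive measure only. For such a set all translates are automatically measurable, because
  they have the same positive measure.
\<close>
lemma (in group) measure_le_inverse_card_translates:
  assumes A: "A \<subseteq> carrier G" "finite A" "A \<noteq> {}"
    and total: "emeasure \<mu> (carrier G) = 1" and space: "space \<mu> = carrier G"
    and invariant: "\<And>g C. \<lbrakk>g \<in> carrier G; C \<in> sets \<mu>\<rbrakk> \<Longrightarrow> emeasure \<mu> (g <# C) = emeasure \<mu> C"
    and disjoint: "disjoint_family_on (\<lambda>a. inv a <# B) A"
  shows "measure \<mu> B \<le> 1 / real (card A)"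
proof (cases "measure \<mu> B = 0")
  case True
  thus ?thesis by simp
next
  case False
  interpret finite_measure \<mu>
    by standard (simp add: space total)
  have B: "B \<in> sets \<mu>"
    using False measure_notin_sets by blast
  have translate: "measure \<mu> (inv a <# B) = measure \<mu> B" if "a \<in> A" for a
    using invariant[of "inv a" B] that A B by (auto simp: measure_def)
  have "real (card A) * measure \<mu> B = (\<Sum>a\<in>A. measure \<mu> (inv a <# B))"
    by (simp add: translate)
  also have "\<dots> = measure \<mu> (\<Union>a\<in>A. inv a <# B)"
  proof (rule finite_measure_finite_Union[symmetric])
    show "(\<lambda>a. inv a <# B) ` A \<subseteq> sets \<mu>"
      using translate False measure_notin_sets by fastforce
  qed (use A disjoint in auto)
  also have "\<dots> \<le> measure \<mu> (space \<mu>)"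
    by (rule bounded_measure)
  also have "\<dots> = 1"
    by (simp add: measure_def space total)
  finally show ?thesis
    using A by (simp add: field_simps card_gt_0_iff)
qed

text \<open>
  Boundedness makes the suprema that define displacements genuine, and nonemptiness makes
  them least upper bounds.
\<close>
locale bounded_metric_action = group_action G X act + Metric_space X m
  for G (structure) and X :: "'x set" and act m +
  assumes bounded: "mbounded X" and nonempty: "X \<noteq> {}"
begin

abbreviation disp :: "'a \<Rightarrow> real" where
  "disp \<equiv> displacement X m act"

lemma act_in: "\<lbrakk>g \<in> carrier G; x \<in> X\<rbrakk> \<Longrightarrow> act g x \<in> X"
  using element_image by blast

lemma dist_act_le_displacement:
  assumes "g \<in> carrier G" "x \<in> X"
  shows "m (act g x) x \<le> disp g"
proof -
  obtain C where "\<forall>x\<in>X. \<forall>y\<in>X. m x y \<le> C"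
    using bounded mbounded_alt by blast
  hence "bdd_above ((\<lambda>x. m (act g x) x) ` X)"
    using assms(1) act_in by (intro bdd_aboveI[of _ C]) auto
  thus ?thesis
    unfolding displacement_def using assms(2) by (intro cSUP_upper)
qed

lemma displacement_least:
  "(\<And>x. x \<in> X \<Longrightarrow> m (act g x) x \<le> c) \<Longrightarrow> disp g \<le> c"
  unfolding displacement_def using nonempty by (rule cSUP_least)

text \<open>
  A quotient \<open>g h\<^sup>-\<^sup>1\<close> moves the point \<open>h z\<close> to \<open>g z\<close>, and every point is of the form \<open>h z\<close>. Both
  \<open>h z\<close> and \<open>g z\<close> are close to \<open>z\<close>, which is the intermediate point for the triangle inequality
  in either of its forms.
\<close>
lemma displacement_quotient_le:
  assumes g: "g \<in> carrier G" and h: "h \<in> carrier G"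
    and through: "\<And>z. z \<in> X \<Longrightarrow> m (act g z) (act h z) \<le> c"
  shows "disp (g \<otimes> inv h) \<le> c"
proof (rule displacement_least)
  interpret group G
    using group_hom group_hom.axioms(1) by blast
  fix x assume x: "x \<in> X"
  define z where "z = act (inv h) x"
  have z: "z \<in> X"
    unfolding z_def using act_in h x by simp
  have hz: "act h z = x"
    unfolding z_def using orbit_sym_aux[of "inv h" x] h x by simp
  have "act (g \<otimes> inv h) x = act g z"
    unfolding z_def using composition_rule g h x by simp
  thus "m (act (g \<otimes> inv h) x) x \<le> c"
    using through[OF z] hz by simp
qed

lemma displacement_quotient_le_add:
  assumes "g \<in> carrier G" "h \<in> carrier G"
  shows "disp (g \<otimes> inv h) \<le> disp g + disp h"
proof (rule displacement_quotient_le[OF assms])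
  fix z assume z: "z \<in> X"
  have "m (act g z) (act h z) \<le> m (act g z) z + m (act h z) z"
    using triangle[of "act g z" z "act h z"] commute[of z "act h z"] act_in assms z by simp
  thus "m (act g z) (act h z) \<le> disp g + disp h"
    using dist_act_le_displacement[OF assms(1) z] dist_act_le_displacement[OF assms(2) z] by simp
qed

lemma displacement_quotient_le_max:
  assumes "nonarchimedean_on X m" "g \<in> carrier G" "h \<in> carrier G"
  shows "disp (g \<otimes> inv h) \<le> max (disp g) (disp h)"
proof (rule displacement_quotient_le[OF assms(2,3)])
  fix z assume z: "z \<in> X"
  have "m (act g z) (act h z) \<le> max (m (act g z) z) (m (act h z) z)"
    using assms z act_in commute[of z "act h z"] unfolding nonarchimedean_on_def by metis
  thus "m (act g z) (act h z) \<le> max (disp g) (disp h)"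
    using dist_act_le_displacement[OF assms(2) z] dist_act_le_displacement[OF assms(3) z] by simp
qed

text \<open>
  The packing bound in terms of a radius: it holds as soon as quotients of elements of
  displacement below \<open>r\<close> stay below the minimal displacement of \<open>A\<close>. The ordinary and the
  nonarchimedean case differ only in the \<open>r\<close> for which the triangle inequality ensures this.
\<close>
lemma displacement_distribution_le_inverse_card:
  assumes A: "A \<subseteq> carrier G" "finite A" "A \<noteq> {}"
    and total: "emeasure \<mu> (carrier G) = 1" and space: "space \<mu> = carrier G"
    and invariant: "\<And>g C. \<lbrakk>g \<in> carrier G; C \<in> sets \<mu>\<rbrakk> \<Longrightarrow> emeasure \<mu> (g <# C) = emeasure \<mu> C"
    and quotients: "\<And>g h. \<lbrakk>g \<in> carrier G; h \<in> carrier G; disp g < r; disp h < r\<rbrakk>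
                      \<Longrightarrow> disp (g \<otimes> inv h) < min_displacement G X m act A"
  shows "displacement_distribution G X m act \<mu> r \<le> 1 / real (card A)"
proof -
  interpret group G
    using group_hom group_hom.axioms(1) by blast
  have separated: "min_displacement G X m act A \<le> disp (a \<otimes> inv b)"
    if "a \<in> A" "b \<in> A" "a \<noteq> b" for a b
    unfolding min_displacement_def
  proof (rule Min_le)
    have "{disp (a \<otimes> inv b) |a b. a \<in> A \<and> b \<in> A \<and> a \<noteq> b}
            \<subseteq> (\<lambda>(a, b). disp (a \<otimes> inv b)) ` (A \<times> A)"
      by auto
    thus "finite {disp (a \<otimes> inv b) |a b. a \<in> A \<and> b \<in> A \<and> a \<noteq> b}"
      by (rule finite_subset) (simp add: A)
  qed (use that in blast)
  have "disjoint_family_on (\<lambda>a. inv a <# {g \<in> carrier G. disp g < r}) A"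
    by (rule disjoint_left_translates) (use A separated quotients in force)+
  thus ?thesis
    unfolding displacement_distribution_def
    by (intro measure_le_inverse_card_translates A total space invariant)
qed

end

text \<open>
  The empty set has only one permutation, so only a trivial group acts on it faithfully.
\<close>
lemma (in faithful_action) nonempty_if_card_ge_2:
  assumes "A \<subseteq> carrier G" "card A \<ge> 2"
  shows "E \<noteq> {}"
proof
  assume "E = {}"
  hence same: "\<phi> a = \<phi> b" if "a \<in> carrier G" "b \<in> carrier G" for a b
    using bij_prop0[OF that(1)] bij_prop0[OF that(2)] by (auto simp: Bij_def)
  have "a = b" if "a \<in> A" "b \<in> A" for a b
    using same[of a b] inj_onD[OF faithful, of a b] that assms(1) by blast
  hence "is_singleton A \<or> A = {}"
    by (meson all_not_in_conv is_singletonI')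
  hence "card A \<le> 1"
    by (auto simp: is_singleton_altdef)
  thus False
    using assms(2) by simp
qed

theorem theorem3:
  fixes G :: "('a, 'b) monoid_scheme"
    and T :: "'a topology"
    and X :: "'x set"
    and m :: "'x \<Rightarrow> 'x \<Rightarrow> real"
    and act :: "'a \<Rightarrow> 'x \<Rightarrow> 'x"
    and \<mu> :: "'a measure"
    and A :: "'a set"
  assumes "topological_group G T"
    and "compact_space T"
    and "Metric_space X m"
    and "compact_space (Metric_space.mtopology X m)"
    and "faithful_action G X act"
    and "continuous_map (prod_topology T (Metric_space.mtopology X m))
           (Metric_space.mtopology X m) (\<lambda>(g, x). act g x)"
    and "normalized_haar_measure G T \<mu>"
    and "A \<subseteq> carrier G"
    and "finite A"
    and "card A \<ge> 2"
  shows "displacement_distribution G X m act \<mu> (min_displacement G X m act A / 2)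
           \<le> 1 / real (card A) \<and>
         (nonarchimedean_on X m \<longrightarrow>
           displacement_distribution G X m act \<mu> (min_displacement G X m act A)
             \<le> 1 / real (card A))"
proof -
  interpret topological_group G T
    by (rule assms(1))
  interpret faithful_action G X act
    by (rule assms(5))
  interpret Metric_space X m
    by (rule assms(3))
  interpret bounded_metric_action G X act m
  proof
    show "mbounded X"
      using assms(4) compactin_imp_mbounded by (simp add: compact_space_def)
    show "X \<noteq> {}"
      using nonempty_if_card_ge_2 assms(8,10) .
  qed
  let ?\<delta> = "min_displacement G X m act A"
  have A: "A \<noteq> {}"
    using assms(10) by auto
  have \<mu>: "emeasure \<mu> (carrier G) = 1" "space \<mu> = carrier G"
    "\<And>g C. \<lbrakk>g \<in> carrier G; C \<in> sets \<mu>\<rbrakk> \<Longrightarrow> emeasure \<mu> (g <#\<^bsub>G\<^esub> C) = emeasure \<mu> C"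
    using assms(7) topspace_eq_carrier unfolding normalized_haar_measure_def by auto
  have packing: "displacement_distribution G X m act \<mu> r \<le> 1 / real (card A)"
    if "\<And>g h. \<lbrakk>g \<in> carrier G; h \<in> carrier G; disp g < r; disp h < r\<rbrakk>
          \<Longrightarrow> disp (g \<otimes>\<^bsub>G\<^esub> inv\<^bsub>G\<^esub> h) < ?\<delta>" for r
    using displacement_distribution_le_inverse_card[OF assms(8,9) A \<mu> that] .
  show ?thesis
  proof (intro conjI impI)
    show "displacement_distribution G X m act \<mu> (?\<delta> / 2) \<le> 1 / real (card A)"
      by (rule packing) (use displacement_quotient_le_add in force)
  next
    assume "nonarchimedean_on X m"
    thus "displacement_distribution G X m act \<mu> ?\<delta> \<le> 1 / real (card A)"
      by (intro packing) (use displacement_quotient_le_max in force)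
  qed
qed

end
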